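(* Let $m,M\in\{0.01,0.02,\dots,0.99\}$ with $m\le M$ and $\varepsilon\in\{0,0.01,\dots,1.99,2\}\cup\{2.1,2.2,\dots,10\}\cup\{11,12,\dots,100\}$. For $N\in\mathbb{N}$, $J\subseteq[N]$, $a=(a_1,\dots,a_N)\in[m,M]^N$ and $z=(z_1,\dots,z_N)\in P_a$, let \[ f_{J,N}(a;z)=\Big(e^{\varepsilon}-(e^{\varepsilon}-1)\frac{m+\sum_{i=1}^Na_i}{N+1}\Big)\prod_{i\in J}\frac{N+\frac{a_i}{z_i}}{N+1}\prod_{i\in[N]\setminus J}\frac{N+\frac{1-a_i}{1-z_i}}{N+1}. \] Then \[ \sup_{N\in\mathbb{N}}\max_{J\subseteq[N]}\max_{a\in[m,M]^N}\max_{z\in P_a}f_{J,N}(a;z)\le\max_{p\in[0,1]}\max\{L_1(p),L_2(p)\}, \] where \[ L_1(p)=\big(e^{\varepsilon}-(e^{\varepsilon}-1)(pM+(1-p)m)\big)\exp\Big(p\tfrac{M}{m}+(1-p)\tfrac{1-m}{1-(pM+(1-p)m)}-1\Big), \] \[ L_2(p)=\Big(e^{\varepsilon}-(e^{\varepsilon}-1)\Big(pM+(1-p)\tfrac{(M+m)-pM}{2-p}\Big)\Big)\exp\Big(p\tfrac{M}{m}+(1-p)\tfrac{1-\frac{(M+m)-pM}{2-p}}{1-M}-1\Big). \]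
   Context: $[N]=\{1,\dots,N\}$. For $a\in[m,M]^N$, let $M_i=\frac1N\min\{m+(N-1)M,\ (N-2)(a_i-m)+\sum_{j=1}^Na_j\}$ for $i\in[N]$, and let $P_a$ be the set of $z\in[m,M_1]\times\cdots\times[m,M_N]$ satisfying $\sum_{j=1}^Nz_j\le(2N-2)z_i-(N-2)m$ for every $i\in[N]$. *)

theory Defs
  imports Complex_Main
begin

text \<open>Vectors a, z in R^N are functions nat => real, only the indices 1..N matter.\<close>

definition Mi :: "real \<Rightarrow> real \<Rightarrow> nat \<Rightarrow> (nat \<Rightarrow> real) \<Rightarrow> nat \<Rightarrow> real" where
  "Mi m M N a i = (1 / real N) *
     min (m + (real N - 1) * M) ((real N - 2) * (a i - m) + (\<Sum>j = 1..N. a j))"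

definition Pset :: "real \<Rightarrow> real \<Rightarrow> nat \<Rightarrow> (nat \<Rightarrow> real) \<Rightarrow> (nat \<Rightarrow> real) set" where
  "Pset m M N a = {z. (\<forall>i\<in>{1..N}. m \<le> z i \<and> z i \<le> Mi m M N a i) \<and>
     (\<forall>i\<in>{1..N}. (\<Sum>j = 1..N. z j) \<le> (2 * real N - 2) * z i - (real N - 2) * m)}"

definition fJN :: "real \<Rightarrow> real \<Rightarrow> nat set \<Rightarrow> nat \<Rightarrow> (nat \<Rightarrow> real) \<Rightarrow> (nat \<Rightarrow> real) \<Rightarrow> real" where
  "fJN \<epsilon> m J N a z =
     (exp \<epsilon> - (exp \<epsilon> - 1) * ((m + (\<Sum>i = 1..N. a i)) / (real N + 1))) *
     (\<Prod>i\<in>J. (real N + a i / z i) / (real N + 1)) *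
     (\<Prod>i\<in>{1..N} - J. (real N + (1 - a i) / (1 - z i)) / (real N + 1))"

definition L1 :: "real \<Rightarrow> real \<Rightarrow> real \<Rightarrow> real \<Rightarrow> real" where
  "L1 \<epsilon> m M p =
     (exp \<epsilon> - (exp \<epsilon> - 1) * (p * M + (1 - p) * m)) *
     exp (p * (M / m) + (1 - p) * ((1 - m) / (1 - (p * M + (1 - p) * m))) - 1)"

definition L2 :: "real \<Rightarrow> real \<Rightarrow> real \<Rightarrow> real \<Rightarrow> real" where
  "L2 \<epsilon> m M p =
     (let q = ((M + m) - p * M) / (2 - p) in
      (exp \<epsilon> - (exp \<epsilon> - 1) * (p * M + (1 - p) * q)) *
      exp (p * (M / m) + (1 - p) * ((1 - q) / (1 - M)) - 1))"

definition grid_mM :: "real set" where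
  "grid_mM = {real k / 100 | k. k \<in> {1..99::nat}}"

definition grid_eps :: "real set" where
  "grid_eps = {real k / 100 | k. k \<in> {0..200::nat}} \<union> {real k / 10 | k. k \<in> {21..100::nat}}
     \<union> {real k | k. k \<in> {11..100::nat}}"

end

theory Submission
  imports Defs "HOL-Analysis.Convex"
begin

text \<open>
  Put \<open>D = M - m\<close>, \<open>s = 1 - M\<close>, \<open>\<alpha>\<^sub>i = a\<^sub>i - m\<close>, \<open>y\<^sub>i = z\<^sub>i - m\<close> and \<open>(N + 1) * T = \<Sum>\<alpha>\<^sub>i\<close>. Each factor of
  the product is at most \<open>exp (g\<^sub>i / (N + 1))\<close> with \<open>g\<^sub>i\<close> the larger of \<open>\<alpha>\<^sub>i / m\<close> and
  \<open>(y\<^sub>i - \<alpha>\<^sub>i) / (D + s - y\<^sub>i)\<close>. As \<open>N\<close> tends to infinity the constraints become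
  \<open>y\<^sub>i \<le> min D (\<alpha>\<^sub>i + T)\<close>, so \<open>g\<^sub>i\<close> is bounded by a function of \<open>\<alpha>\<^sub>i\<close> that is convex between its
  vertices \<open>0\<close>, \<open>D - T\<close> and \<open>D\<close>, where it has the values \<open>T / (D + s - T)\<close>, \<open>T / s\<close> (unless
  \<open>\<alpha>\<^sub>i / m\<close> dominates) and \<open>D / m\<close>. Hence the mean of the \<open>g\<^sub>i\<close> is at most \<open>l T\<close> for every affine
  \<open>l\<close> above these three points. For finite \<open>N\<close> the same \<open>l\<close> works: the first factor of the
  statement averages over the \<open>N + 1\<close> numbers \<open>m, a\<^sub>1, \<dots>, a\<^sub>N\<close>, and the unused contribution \<open>l 0\<close>
  of the additional \<open>m\<close>, distributed over the indices in proportion to \<open>D - \<alpha>\<^sub>i\<close>, pays for the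
  weaker constraints on \<open>y\<^sub>i\<close>.
\<close>

section \<open>Positivity of the polynomial \<open>gap\<close>\<close>

text \<open>With \<open>y = D - w / n\<close>, this is \<open>n * k * s * (D - T + s)\<close> times the slack in
  \<open>y - \<alpha> \<le> (D + s - y) * r\<close>, where \<open>r\<close> is the bound of \<open>ratio_le_affine\<close> for the chord through
  the vertices \<open>0\<close> and \<open>D - T\<close>. It is increasing in \<open>w\<close>, affine in \<open>\<alpha>\<close> for fixed \<open>w\<close>, and
  quadratic in \<open>\<alpha>\<close> along \<open>w = k - (n - 2) * \<alpha>\<close>, so positivity is reduced to end points.\<close>

definition gap :: "real \<Rightarrow> real \<Rightarrow> real \<Rightarrow> real \<Rightarrow> real \<Rightarrow> real \<Rightarrow> real \<Rightarrow> real" where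
  "gap n D s T k \<alpha> w =
     s\<^sup>2 * (n * T * (D - \<alpha>) - (k + T - n * \<alpha> - w) * k)
     + s * (T * w * (D - \<alpha>) - D * (k + T - n * \<alpha> - w) * k) + T * \<alpha> * w * k"

lemma gap_mono:
  assumes "0 \<le> D" "0 \<le> s" "0 \<le> T" "0 \<le> k" "0 \<le> \<alpha>" "\<alpha> \<le> D" "w \<le> w'"
  shows "gap n D s T k \<alpha> w \<le> gap n D s T k \<alpha> w'"
proof -
  have "gap n D s T k \<alpha> w' - gap n D s T k \<alpha> w =
    (w' - w) * (s\<^sup>2 * k + s * (D * k + T * (D - \<alpha>)) + T * \<alpha> * k)"
    unfolding gap_def by algebra
  also have "\<dots> \<ge> 0" using assms by (intro mult_nonneg_nonneg add_nonneg_nonneg) auto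
  finally show ?thesis by simp
qed

text \<open>The bound on \<open>w\<close> gives
  \<open>k + T - n * \<alpha> - w \<le> T - 2 * \<alpha> \<le> 0\<close>, so each of the three terms
  is nonnegative by itself.\<close>

lemma gap_nonneg_large:
  assumes "1 \<le> n" "0 < D" "0 < s" "0 \<le> T" "0 < k" "0 \<le> \<alpha>" "\<alpha> \<le> D" "0 \<le> w"
    and "k - (n - 2) * \<alpha> \<le> w" "T \<le> 2 * \<alpha>"
  shows "0 \<le> gap n D s T k \<alpha> w"
proof -
  have e: "k + T - n * \<alpha> - w \<le> 0" using assms by (simp add: algebra_simps)
  then have "(k + T - n * \<alpha> - w) * k \<le> 0" "D * (k + T - n * \<alpha> - w) * k \<le> 0"
    using assms by (simp_all add: mult_nonpos_nonneg mult_nonneg_nonpos)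
  moreover have "0 \<le> n * T * (D - \<alpha>)" "0 \<le> T * w * (D - \<alpha>)" "0 \<le> T * \<alpha> * w * k"
    using assms by simp_all
  ultimately have "0 \<le> n * T * (D - \<alpha>) - (k + T - n * \<alpha> - w) * k"
    "0 \<le> T * w * (D - \<alpha>) - D * (k + T - n * \<alpha> - w) * k" "0 \<le> T * \<alpha> * w * k"
    by linarith+
  then show ?thesis unfolding gap_def using assms by (intro add_nonneg_nonneg mult_nonneg_nonneg) auto
qed

text \<open>This is the coefficient of \<open>s\<^sup>2\<close> in \<open>gap\<close> along
  \<open>w = k - (n - 2) * \<alpha>\<close>. It does not increase with \<open>k\<close>, which is at
  most \<open>n * (D - T)\<close>.\<close>

lemma gap_leading_coeff_nonneg:
  fixes n D T k \<alpha> :: real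
  assumes "0 \<le> n" "0 \<le> T" "T \<le> D" "k = n * D - (n + 1) * T" "0 \<le> \<alpha>" "2 * \<alpha> \<le> T"
  shows "0 \<le> n * T * (D - \<alpha>) - (T - 2 * \<alpha>) * k"
proof -
  have "(T - 2 * \<alpha>) * k \<le> (T - 2 * \<alpha>) * (n * (D - T))"
    using assms by (intro mult_left_mono) (auto simp: algebra_simps)
  moreover have "n * T * (D - \<alpha>) - (T - 2 * \<alpha>) * (n * (D - T)) =
      n * (T * (T - 2 * \<alpha>) + \<alpha> * (D - T) + \<alpha> * D)"
    by (simp add: algebra_simps)
  moreover have "0 \<le> n * (T * (T - 2 * \<alpha>) + \<alpha> * (D - T) + \<alpha> * D)"
    using assms by (intro mult_nonneg_nonneg add_nonneg_nonneg) auto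
  ultimately show ?thesis by linarith
qed

lemma quadratic_nonneg:
  fixes a b c x :: real
  assumes "0 \<le> a" "0 \<le> c" "b\<^sup>2 \<le> 4 * a * c"
  shows "0 \<le> a * x\<^sup>2 + b * x + c"
proof (cases "a = 0")
  case True
  then show ?thesis using assms by simp
next
  case False
  have "4 * a * (a * x\<^sup>2 + b * x + c) = (2 * a * x + b)\<^sup>2 + (4 * a * c - b\<^sup>2)" by algebra
  also have "\<dots> \<ge> 0" using assms by simp
  finally show ?thesis using False assms by (simp add: zero_le_mult_iff)
qed

text \<open>At \<open>\<beta>\<close> the two lower bounds \<open>D\<close> and
  \<open>k - (n - 2) * \<alpha>\<close> for \<open>w\<close> coincide. There \<open>gap\<close> is a
  quadratic in \<open>s\<close> with nonnegative outer coefficients; if the linear coefficient is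
  not positive, neither is the discriminant.\<close>

lemma gap_nonneg_vertex:
  assumes n: "2 < n" and D: "0 < D" and s: "0 \<le> s" and T: "0 \<le> T" and k: "k = n * D - (n + 1) * T" "0 < k"
    and \<beta>: "k = D + (n - 2) * \<beta>" "0 \<le> \<beta>" "2 * \<beta> < T"
  shows "0 \<le> gap n D s T k \<beta> D"
proof -
  define q where "q = T * (n - 1) - 2 * k"
  define r where "r = n * T * (D - \<beta>) - (T - 2 * \<beta>) * k"
  have eq: "gap n D s T k \<beta> D = r * s\<^sup>2 + (- D * \<beta> * q) * s + T * \<beta> * D * k"
    unfolding gap_def q_def r_def \<beta>(1) by algebra
  have TD: "T < D"
  proof -
    have "(n + 1) * T < (n + 1) * D" using k n D by (simp add: algebra_simps)
    then show ?thesis using n by simp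
  qed
  \<comment> \<open>Equate the two forms of \<open>k\<close> and insert
    \<open>2 * \<beta> < T\<close>.\<close>
  have b3: "3 * \<beta> < D"
  proof -
    have "(n + 1) * T = n * D - D - (n - 2) * \<beta>" using k(1) \<beta>(1) by (simp add: algebra_simps)
    moreover have "(n + 1) * (2 * \<beta>) < (n + 1) * T" using \<beta> n by simp
    ultimately have "n * (3 * \<beta>) < n * D" using D by (simp add: algebra_simps)
    then show ?thesis using n by simp
  qed
  have r0: "0 \<le> r"
    unfolding r_def using gap_leading_coeff_nonneg[of n T D k \<beta>] n T TD k \<beta> by simp
  show ?thesis
  proof (cases "0 \<le> q")
    case False
    then have "0 \<le> - D * \<beta> * q" using D \<beta> by (simp add: mult_nonneg_nonpos)
    then have "0 \<le> (- D * \<beta> * q) * s" using s by (rule mult_nonneg_nonneg)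
    moreover have "0 \<le> r * s\<^sup>2" "0 \<le> T * \<beta> * D * k" using r0 T \<beta>(2) D k(2) by simp_all
    ultimately show ?thesis unfolding eq by linarith
  next
    case True
    \<comment> \<open>The discriminant condition is \<open>\<beta> * D\<close> times the product of
      \<open>\<beta> * q \<le> T * k\<close> and \<open>D * q \<le> 4 * r\<close>.\<close>
    have "\<beta> * q \<le> T * k"
    proof -
      have "(n - 1) * \<beta> \<le> k" using \<beta> b3 D by (simp add: algebra_simps)
      then have "T * ((n - 1) * \<beta>) \<le> T * k" using T by (rule mult_left_mono)
      moreover have "0 \<le> \<beta> * (2 * k)" using \<beta> k by simp
      ultimately show ?thesis unfolding q_def by (simp add: algebra_simps)
    qed
    then have 1: "\<beta> * q * (D * q) \<le> T * k * (D * q)" using True D by (intro mult_right_mono) auto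
    have 2: "D * q \<le> 4 * r"
    proof -
      have "2 * D * ((n - 1) * T) \<le> 3 * (D - \<beta>) * ((n - 1) * T)"
        using b3 n T by (intro mult_right_mono) auto
      also have "\<dots> \<le> 3 * (D - \<beta>) * (n * T)" using b3 n T \<beta> by (intro mult_left_mono mult_right_mono) auto
      finally have a: "2 * D * ((n - 1) * T) \<le> 3 * (n * T * (D - \<beta>))" by (simp add: algebra_simps)
      have "(T - 2 * \<beta>) * k \<le> D * k" using TD \<beta> k by (intro mult_right_mono) auto
      moreover have "D * (2 * k) \<le> D * (T * (n - 1))" using True D unfolding q_def by (intro mult_left_mono) auto
      moreover have "0 \<le> D * k" using D k by simp
      ultimately show ?thesis using a unfolding q_def r_def by (simp add: algebra_simps)
    qed
    have "T * k * (D * q) \<le> T * k * (4 * r)" using 2 T k by (intro mult_left_mono) auto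
    with 1 have "\<beta> * q * (D * q) \<le> T * k * (4 * r)" by linarith
    then have "\<beta> * D * (\<beta> * q * (D * q)) \<le> \<beta> * D * (T * k * (4 * r))" using \<beta>(2) D by (intro mult_left_mono) simp_all
    then have "(- D * \<beta> * q)\<^sup>2 \<le> 4 * r * (T * \<beta> * D * k)" by (simp add: power2_eq_square algebra_simps)
    then show ?thesis unfolding eq using r0 T \<beta> D k by (intro quadratic_nonneg) auto
  qed
qed

lemma gap_on_slope:
  "gap n D s T k \<alpha> (k - (n - 2) * \<alpha>) =
     s\<^sup>2 * (n * T * (D - \<alpha>) - (T - 2 * \<alpha>) * k)
     + s * (\<alpha> * ((2 * D - T) * k - T * (n - 2) * (D - \<alpha>)))
     + T * \<alpha> * (k - (n - 2) * \<alpha>) * k"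
  unfolding gap_def by algebra

lemma gap_nonneg:
  assumes n: "1 \<le> n" and D: "0 < D" and s: "0 < s" and T: "0 \<le> T"
    and k: "k = n * D - (n + 1) * T" "0 < k"
    and \<alpha>: "0 \<le> \<alpha>" "\<alpha> \<le> D" and w: "D \<le> w" "k - (n - 2) * \<alpha> \<le> w"
  shows "0 \<le> gap n D s T k \<alpha> w"
proof -
  have TD: "T < D"
  proof -
    have "(n + 1) * T < (n + 1) * D" using k n D by (simp add: algebra_simps)
    then show ?thesis using n by simp
  qed
  have knD: "k \<le> n * D" using k(1) n T by simp
  have mono: "gap n D s T k \<alpha> w' \<le> gap n D s T k \<alpha> w" if "w' \<le> w" for w'
    using gap_mono[of D s T k \<alpha> w' w n] that D s T k \<alpha> by simp
  \<comment> \<open>For \<open>n \<le> 2\<close> all coefficients in \<open>gap_on_slope\<close> are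
    nonnegative; the last two cases differ in which lower bound for \<open>w\<close> is the
    larger.\<close>
  consider "T \<le> 2 * \<alpha>" | "2 * \<alpha> < T" "n \<le> 2" | "2 * \<alpha> < T" "2 < n" "k - (n - 2) * \<alpha> \<le> D"
    | "2 * \<alpha> < T" "2 < n" "D < k - (n - 2) * \<alpha>" by linarith
  then show ?thesis
  proof cases
    case 1
    then show ?thesis using gap_nonneg_large[of n D s T k \<alpha> w] assms by simp
  next
    case 2
    have r: "0 \<le> n * T * (D - \<alpha>) - (T - 2 * \<alpha>) * k"
      using gap_leading_coeff_nonneg[of n T D k \<alpha>] n T TD k \<alpha> 2 by simp
    have "T * (n - 2) * (D - \<alpha>) \<le> 0"
      using T 2 \<alpha> by (intro mult_nonpos_nonneg mult_nonneg_nonpos) auto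
    moreover have "0 \<le> (2 * D - T) * k" using TD D k by simp
    ultimately have q: "0 \<le> (2 * D - T) * k - T * (n - 2) * (D - \<alpha>)" by linarith
    have "(n - 2) * \<alpha> \<le> 0" using 2 \<alpha> by (simp add: mult_nonpos_nonneg)
    then have "0 \<le> k - (n - 2) * \<alpha>" using k by linarith
    then have "0 \<le> gap n D s T k \<alpha> (k - (n - 2) * \<alpha>)"
      unfolding gap_on_slope using r q s T \<alpha> k by (intro add_nonneg_nonneg mult_nonneg_nonneg) auto
    then show ?thesis using mono[OF w(2)] by linarith
  next
    case 3
    \<comment> \<open>Where the sloping bound falls to \<open>D\<close>, or \<open>0\<close> if it
      starts no higher; at \<open>w = D\<close>, \<open>gap\<close> is affine in
      \<open>\<alpha>\<close> between \<open>b\<close> and \<open>D\<close>.\<close>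
    define b where "b = (if k \<le> D then 0 else (k - D) / (n - 2))"
    have b: "0 \<le> b" "b \<le> \<alpha>" using 3 \<alpha> by (auto simp: b_def field_simps)
    have gb: "0 \<le> gap n D s T k b D"
    proof (cases "k \<le> D")
      case True
      have "gap n D s T k 0 D = s\<^sup>2 * (T * (n * D - k) + k * (D - k)) + s * (D * (k + T) * (D - k))"
        unfolding gap_def by algebra
      also have "\<dots> \<ge> 0" using True D s T k knD by (intro add_nonneg_nonneg mult_nonneg_nonneg) auto
      finally show ?thesis using True by (simp add: b_def)
    next
      case False
      then have "k = D + (n - 2) * b" using 3 by (simp add: b_def)
      then show ?thesis using gap_nonneg_vertex[of n D s T k b] 3 D s T k b by simp
    qed
    have gD: "0 \<le> gap n D s T k D D"
    proof -
      have "(n - 2) * \<alpha> \<le> (n - 2) * D" using 3 \<alpha> by (intro mult_left_mono) auto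
      then have "k - (n - 2) * D \<le> D" using 3 by linarith
      then show ?thesis using gap_nonneg_large[of n D s T k D D] n D s T k(2) TD by simp
    qed
    have "(D - b) * gap n D s T k \<alpha> D = (D - \<alpha>) * gap n D s T k b D + (\<alpha> - b) * gap n D s T k D D"
      unfolding gap_def by algebra
    also have "\<dots> \<ge> 0" using gb gD b \<alpha> by (intro add_nonneg_nonneg mult_nonneg_nonneg) auto
    finally have "0 \<le> gap n D s T k \<alpha> D" using b 3 TD by (simp add: zero_le_mult_iff)
    then show ?thesis using mono[OF w(1)] by linarith
  next
    case 4
    have kD: "D < k"
    proof -
      have "0 \<le> (n - 2) * \<alpha>" using 4 \<alpha> by simp
      then show ?thesis using 4 by linarith
    qed
    have r: "0 \<le> n * T * (D - \<alpha>) - (T - 2 * \<alpha>) * k"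
      using gap_leading_coeff_nonneg[of n T D k \<alpha>] n T TD k \<alpha> 4 by simp
    have "0 \<le> gap n D s T k \<alpha> (k - (n - 2) * \<alpha>)"
    \<comment> \<open>The coefficient of \<open>\<alpha>\<^sup>2\<close> along the slope is
      \<open>- T * (n - 2) * (k - s)\<close>. For \<open>s < k\<close> concavity leaves only the end
      points; for \<open>k \<le> s\<close> one factor \<open>s\<close> may be lowered to
      \<open>k\<close>.\<close>
    proof (cases "k \<le> s")
      case True
      let ?r = "n * T * (D - \<alpha>) - (T - 2 * \<alpha>) * k"
      let ?q = "\<alpha> * ((2 * D - T) * k - T * (n - 2) * (D - \<alpha>))"
      have "D * \<alpha> \<le> k * (T - \<alpha>)" using kD D \<alpha> 4 by (intro mult_mono) auto
      moreover have "T * (n - 2) \<le> T * (n + 1)" using T by (intro mult_left_mono) auto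
      ultimately have "(T * (n - 2)) * (D * \<alpha>) \<le> (T * (n + 1)) * (k * (T - \<alpha>))"
        using T n D \<alpha> by (intro mult_mono[where a = "T * (n - 2)"]) auto
      moreover have "0 \<le> k * (\<alpha> * (2 * k + 2 * D)) + T * (n - 2) * \<alpha>\<^sup>2"
        using k D \<alpha> T 4 by (intro add_nonneg_nonneg mult_nonneg_nonneg) auto
      moreover have "k * ?r + ?q = T * (n + 1) * (k * (T - \<alpha>)) - T * (n - 2) * (D * \<alpha>)
          + (k * (\<alpha> * (2 * k + 2 * D)) + T * (n - 2) * \<alpha>\<^sup>2)"
        unfolding k(1) by algebra
      ultimately have "0 \<le> k * ?r + ?q" by linarith
      also have "\<dots> \<le> s * ?r + ?q" using True r by (simp add: mult_right_mono)
      finally have "0 \<le> s * (s * ?r + ?q)" using s by simp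
      moreover have "0 \<le> T * \<alpha> * (k - (n - 2) * \<alpha>) * k" using T \<alpha> 4 D k by simp
      ultimately show ?thesis unfolding gap_on_slope by (simp add: power2_eq_square distrib_left mult.assoc)
    next
      case False
      define b where "b = (k - D) / (n - 2)"
      \<comment> \<open>At \<open>c\<close> either the sloping bound equals \<open>D\<close>, or
        \<open>2 * c = T\<close> and \<open>gap_nonneg_large\<close> applies.\<close>
      define c where "c = min b (T / 2)"
      have kb: "k = D + (n - 2) * b" using 4 by (simp add: b_def)
      have "\<alpha> < b" using 4 by (simp add: b_def field_simps)
      then have c: "\<alpha> < c" "c \<le> b" "0 < c" using 4 \<alpha> by (auto simp: c_def)
      have "gap n D s T k 0 (k - (n - 2) * 0) = s\<^sup>2 * (T * (n * D - k))"
        unfolding gap_def by algebra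
      also have "\<dots> \<ge> 0" using T knD by simp
      finally have g0: "0 \<le> gap n D s T k 0 (k - (n - 2) * 0)" .
      have gc: "0 \<le> gap n D s T k c (k - (n - 2) * c)"
      proof (cases "2 * b < T")
        case True
        then have "c = b" by (simp add: c_def)
        moreover have "k - (n - 2) * b = D" using kb by simp
        moreover have "0 \<le> gap n D s T k b D"
          using gap_nonneg_vertex[OF _ D _ T k kb] True 4 s c by simp
        ultimately show ?thesis by simp
      next
        case False
        then have c': "2 * c = T" by (simp add: c_def)
        have "(n - 2) * c \<le> (n - 2) * b" using c 4 by (intro mult_left_mono) auto
        then have "0 \<le> k - (n - 2) * c" using kb D by linarith
        then show ?thesis using gap_nonneg_large[of n D s T k c "k - (n - 2) * c"] n D s T k c c' TD by simp
      qed
      have "c * gap n D s T k \<alpha> (k - (n - 2) * \<alpha>) =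
          (c - \<alpha>) * gap n D s T k 0 (k - (n - 2) * 0) + \<alpha> * gap n D s T k c (k - (n - 2) * c)
          + T * (n - 2) * (k - s) * (\<alpha> * (c - \<alpha>) * c)"
        unfolding gap_def by algebra
      also have "\<dots> \<ge> 0" using g0 gc False T 4 \<alpha> c by (intro add_nonneg_nonneg mult_nonneg_nonneg) auto
      finally show ?thesis using c by (simp add: zero_le_mult_iff)
    qed
    then show ?thesis using mono[OF w(2)] by linarith
  qed
qed

section \<open>Affine bound for a single index\<close>

text \<open>For the affine \<open>l\<close> with \<open>l 0 = v\<close> and \<open>l D = d\<close>,
  the bound is \<open>l \<alpha> + v * (D - \<alpha>) / k\<close>. The assumptions on
  \<open>v\<close> and \<open>d\<close> put \<open>l\<close> above the vertices at \<open>0\<close>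
  and \<open>D - T\<close>.\<close>

lemma ratio_le_affine:
  fixes n D s T k \<alpha> y v d :: real
  assumes n: "1 \<le> n" and D: "0 < D" and s: "0 < s" and T: "0 \<le> T"
    and k: "k = n * D - (n + 1) * T" "0 < k"
    and \<alpha>: "0 \<le> \<alpha>" "\<alpha> \<le> D"
    and y: "n * y \<le> (n - 1) * D" "n * y \<le> (n - 2) * \<alpha> + (n + 1) * T"
    and v: "T / (D + s - T) \<le> v" and d: "0 \<le> d" and vd: "D * T / s \<le> T * v + (D - T) * d"
  shows "(y - \<alpha>) / (D + s - y) \<le> v * ((D - \<alpha>) * (k + D) / k) / D + d * \<alpha> / D"
proof -
  define x where "x = D - T"
  define P where "P = (D - \<alpha>) * (k + D) / k"
  have x: "0 < x"
  proof -
    have "(n + 1) * T < (n + 1) * D" using k n D by (simp add: algebra_simps)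
    then show ?thesis using n by (simp add: x_def)
  qed
  have xs: "D + s - T = x + s" by (simp add: x_def)
  have v0: "0 \<le> v" using v T x s xs by (smt (verit) divide_nonneg_pos)
  have yD: "y \<le> D"
  proof -
    have "n * y \<le> n * D" using y(1) D by (simp add: algebra_simps)
    then show ?thesis using n by simp
  qed
  have P0: "D - \<alpha> \<le> P"
  proof -
    have "P = (D - \<alpha>) + (D - \<alpha>) * D / k" using k by (simp add: P_def field_simps)
    moreover have "0 \<le> (D - \<alpha>) * D / k" using k D \<alpha> by simp
    ultimately show ?thesis by linarith
  qed
  have "(y - \<alpha>) * D \<le> (D + s - y) * (v * P + d * \<alpha>)"
  \<comment> \<open>With \<open>D - \<alpha>\<close> in place of \<open>P\<close> this reads
    \<open>D - T \<le> \<alpha>\<close>, the side of the middle vertex where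
    \<open>y \<le> D\<close> suffices.\<close>
  proof (cases "P * x \<le> \<alpha> * T")
    case True
    show ?thesis
    proof (cases "T = 0")
      case True
      then have "P \<le> 0" using \<open>P * x \<le> \<alpha> * T\<close> x by (simp add: mult_le_0_iff)
      then have "\<alpha> = D" using P0 \<alpha> by linarith
      then have "(y - \<alpha>) * D \<le> 0" using yD D by (simp add: mult_nonpos_nonneg)
      moreover have "0 \<le> (D + s - y) * (v * P + d * \<alpha>)"
        using yD s v0 P0 \<alpha> d by (intro mult_nonneg_nonneg add_nonneg_nonneg) auto
      ultimately show ?thesis by linarith
    next
      case False
      then have T': "0 < T" using T by simp
      have "P * (D * T / s) \<le> P * (T * v + x * d)" using vd P0 \<alpha> by (intro mult_left_mono) (auto simp: x_def)
      also have "\<dots> = P * T * v + d * (P * x)" by algebra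
      also have "\<dots> \<le> P * T * v + d * (\<alpha> * T)" using True d by (simp add: mult_left_mono)
      also have "\<dots> = T * (v * P + d * \<alpha>)" by algebra
      finally have "T * (P * D / s) \<le> T * (v * P + d * \<alpha>)" by (simp add: mult.commute mult.left_commute)
      then have *: "P * D / s \<le> v * P + d * \<alpha>" using T' by (rule mult_left_le_imp_le)
      have "(y - \<alpha>) * D \<le> P * D" using yD P0 D by simp
      also have "\<dots> = s * (P * D / s)" using s by simp
      also have "\<dots> \<le> (D + s - y) * (v * P + d * \<alpha>)"
        using * yD s P0 \<alpha> D by (intro mult_mono) auto
      finally show ?thesis .
    qed
  next
    case False
    define w where "w = n * (D - y)"
    have "0 \<le> gap n D s T k \<alpha> w"
      using y by (intro gap_nonneg[OF n D s T k \<alpha>]) (simp_all add: w_def k(1) algebra_simps)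
    also have "gap n D s T k \<alpha> w =
        n * ((D + s - y) * T * (\<alpha> * k + s * k + s * (D - \<alpha>)) - k * s * (x + s) * (y - \<alpha>))"
      unfolding gap_def w_def x_def k(1) by algebra
    finally have "k * s * (x + s) * (y - \<alpha>) \<le> (D + s - y) * T * (\<alpha> * k + s * k + s * (D - \<alpha>))"
      using n by (simp add: zero_le_mult_iff)
    then have main: "y - \<alpha> \<le> (D + s - y) * (T * (\<alpha> * k + s * k + s * (D - \<alpha>)) / (k * s * (x + s)))"
      using k s x by (simp add: pos_le_divide_eq mult.commute mult.left_commute)
    \<comment> \<open>The two lower bounds on \<open>v\<close> and \<open>d\<close> are combined
      with weights \<open>\<alpha> / x\<close> and \<open>P - \<alpha> * T / x\<close>, nonnegative
      in this case.\<close>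
    have "T * (\<alpha> * k + s * k + s * (D - \<alpha>)) / (k * s * (x + s)) * D
        = \<alpha> / x * (D * T / s) + (P - \<alpha> * T / x) * (T / (x + s))"
    proof -
      have D': "D = x + T" by (simp add: x_def)
      show ?thesis using k(2) s x unfolding P_def D' by (simp add: divide_simps) algebra
    qed
    also have "\<dots> \<le> \<alpha> / x * (T * v + x * d) + (P - \<alpha> * T / x) * v"
    proof (intro add_mono mult_left_mono)
      show "0 \<le> P - \<alpha> * T / x" using False x by (simp add: field_simps)
    qed (use v vd x \<alpha> in \<open>auto simp: x_def algebra_simps\<close>)
    also have "\<dots> = v * P + d * \<alpha>" using x by (simp add: field_simps)
    finally have "(D + s - y) * (T * (\<alpha> * k + s * k + s * (D - \<alpha>)) / (k * s * (x + s)) * D)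
        \<le> (D + s - y) * (v * P + d * \<alpha>)" using yD s by (intro mult_left_mono) auto
    moreover have "(y - \<alpha>) * D \<le> (D + s - y) * (T * (\<alpha> * k + s * k + s * (D - \<alpha>)) / (k * s * (x + s))) * D"
      using main D by (intro mult_right_mono) auto
    ultimately show ?thesis by (simp add: mult.assoc)
  qed
  then have "(y - \<alpha>) / (D + s - y) \<le> (v * P + d * \<alpha>) / D"
    using yD s D by (simp add: divide_le_eq le_divide_eq mult.commute)
  then show ?thesis by (simp add: P_def add_divide_distrib)
qed

section \<open>Log-convexity, passage to exponentials, boundedness of the supremum\<close>

text \<open>\<open>ln (\<phi> u)\<close> is convex: \<open>ln (1 + K * u)\<close> has second
  derivative at least \<open>- 1 / u\<^sup>2\<close>, and \<open>G / u\<close> with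
  \<open>G = C * (C + s) / s\<close> outweighs this because
  \<open>u \<le> C \<le> G\<close>.\<close>

lemma tilted_le_max_endpoints:
  fixes K C s u u0 :: real
  defines "\<phi> \<equiv> \<lambda>u. (1 + K * u) * exp ((C - u) * (C + s - u) / (s * u))"
  assumes K: "0 \<le> K" and s: "0 < s" and u: "0 < u0" "u0 \<le> u" "u \<le> C"
  shows "\<phi> u \<le> max (\<phi> u0) (\<phi> C)"
proof -
  define G where "G = C * (C + s) / s"
  define f where "f u = ln (1 + K * u) + G / u + u / s - (2 * C + s) / s" for u
  define f' where "f' u = K / (1 + K * u) - G / u\<^sup>2 + 1 / s" for u
  define f'' where "f'' u = 2 * G / u ^ 3 - K\<^sup>2 / (1 + K * u)\<^sup>2" for u
  have pos: "0 < 1 + K * x" if "0 < x" for x using that K by (simp add: add_pos_nonneg)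
  have "convex_on {u0..C} f"
  proof (rule f''_ge0_imp_convex)
    fix x assume x: "x \<in> {u0..C}"
    then have x0: "0 < x" "x \<le> C" using u by auto
    note p = pos[OF x0(1)]
    show "(f has_real_derivative f' x) (at x)"
      unfolding f_def f'_def using x0 p s
      by (auto intro!: derivative_eq_intros simp: power2_eq_square)
    show "(f' has_real_derivative f'' x) (at x)"
      unfolding f'_def f''_def using x0 p s
      by (auto intro!: derivative_eq_intros simp: power2_eq_square power3_eq_cube mult_ac)
    have "(K * x)\<^sup>2 \<le> (1 + K * x)\<^sup>2" using K x0 by (intro power_mono) auto
    then have "K\<^sup>2 / (1 + K * x)\<^sup>2 \<le> 1 / x\<^sup>2" using p x0 by (simp add: field_simps)
    also have "1 / x\<^sup>2 \<le> 2 * G / x ^ 3"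
    proof -
      have "s * x \<le> (C + s) * C" using s x0 by (intro mult_mono) auto
      also have "\<dots> \<le> 2 * C * (C + s)" using s x0 by (simp add: mult_nonneg_nonneg)
      finally have "s * x / (s * x ^ 3) \<le> 2 * C * (C + s) / (s * x ^ 3)"
        using s x0 by (intro divide_right_mono) auto
      then show ?thesis using s x0 by (simp add: G_def power2_eq_square power3_eq_cube mult.assoc)
    qed
    finally show "0 \<le> f'' x" by (simp add: f''_def)
  qed simp
  then have "f u \<le> max (f u0) (f C)" using u by (intro convex_on_le_max) auto
  moreover have "\<phi> x = exp (f x)" if "0 < x" for x
  proof -
    have "(C - x) * (C + s - x) / (s * x) = G / x + x / s - (2 * C + s) / s"
      using that s by (simp add: G_def field_simps)
    then show ?thesis using pos[OF that] by (simp add: \<phi>_def f_def exp_add exp_diff)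
  qed
  ultimately show ?thesis using u by (auto simp: max_def split: if_splits)
qed

text \<open>Each factor is \<open>1 + t \<le> exp t\<close> with
  \<open>t = (x - 1) / (N + 1)\<close>. As \<open>b i\<close> bounds both alternatives, the choice
  of \<open>J\<close> disappears.\<close>

lemma fJN_le_exp:
  assumes J: "J \<subseteq> {1..N}" and F: "0 \<le> exp \<epsilon> - (exp \<epsilon> - 1) * ((m + (\<Sum>i = 1..N. a i)) / (real N + 1))"
    and az: "\<And>i. i \<in> {1..N} \<Longrightarrow> 0 \<le> a i \<and> a i \<le> 1 \<and> 0 < z i \<and> z i < 1"
    and b: "\<And>i. i \<in> {1..N} \<Longrightarrow> a i / z i - 1 \<le> b i" "\<And>i. i \<in> {1..N} \<Longrightarrow> (1 - a i) / (1 - z i) - 1 \<le> b i"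
  shows "fJN \<epsilon> m J N a z \<le> (exp \<epsilon> - (exp \<epsilon> - 1) * ((m + (\<Sum>i = 1..N. a i)) / (real N + 1)))
     * exp ((\<Sum>i = 1..N. b i) / (real N + 1))"
proof -
  have step: "0 \<le> (real N + x) / (real N + 1) \<and> (real N + x) / (real N + 1) \<le> exp (c / (real N + 1))"
    if "0 \<le> x" "x - 1 \<le> c" for x c
  proof -
    have "(real N + x) / (real N + 1) = 1 + (x - 1) / (real N + 1)" by (simp add: field_simps)
    also have "\<dots> \<le> 1 + c / (real N + 1)" using that by (simp add: divide_right_mono)
    also have "\<dots> \<le> exp (c / (real N + 1))" by (rule exp_ge_add_one_self)
    finally show ?thesis using that by simp
  qed
  have "(\<Prod>i\<in>J. (real N + a i / z i) / (real N + 1)) \<le> (\<Prod>i\<in>J. exp (b i / (real N + 1)))"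
  proof (rule prod_mono)
    fix i assume "i \<in> J"
    then have "i \<in> {1..N}" using J by auto
    then show "0 \<le> (real N + a i / z i) / (real N + 1) \<and>
        (real N + a i / z i) / (real N + 1) \<le> exp (b i / (real N + 1))"
      using az[of i] b(1)[of i] by (intro step) auto
  qed
  moreover have "(\<Prod>i\<in>{1..N} - J. (real N + (1 - a i) / (1 - z i)) / (real N + 1))
      \<le> (\<Prod>i\<in>{1..N} - J. exp (b i / (real N + 1)))"
  proof (rule prod_mono)
    fix i assume "i \<in> {1..N} - J"
    then show "0 \<le> (real N + (1 - a i) / (1 - z i)) / (real N + 1) \<and>
        (real N + (1 - a i) / (1 - z i)) / (real N + 1) \<le> exp (b i / (real N + 1))"
      using az[of i] b(2)[of i] by (intro step) auto
  qed
  moreover have "0 \<le> (\<Prod>i\<in>{1..N} - J. (real N + (1 - a i) / (1 - z i)) / (real N + 1))"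
  proof (rule prod_nonneg)
    fix i assume "i \<in> {1..N} - J"
    then show "0 \<le> (real N + (1 - a i) / (1 - z i)) / (real N + 1)"
      using az[of i] by (intro divide_nonneg_nonneg add_nonneg_nonneg) auto
  qed
  ultimately have "(\<Prod>i\<in>J. (real N + a i / z i) / (real N + 1)) *
      (\<Prod>i\<in>{1..N} - J. (real N + (1 - a i) / (1 - z i)) / (real N + 1))
      \<le> (\<Prod>i\<in>J. exp (b i / (real N + 1))) * (\<Prod>i\<in>{1..N} - J. exp (b i / (real N + 1)))"
    by (intro mult_mono) (auto intro: prod_nonneg)
  also have "\<dots> = (\<Prod>i = 1..N. exp (b i / (real N + 1)))"
    using J by (simp add: prod.subset_diff mult.commute)
  also have "\<dots> = exp ((\<Sum>i = 1..N. b i) / (real N + 1))"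
    by (simp add: exp_sum sum_divide_distrib)
  finally show ?thesis unfolding fJN_def mult.assoc using F by (rule mult_left_mono)
qed

text \<open>A real \<open>SUP\<close> is informative only for a set bounded above, which continuity
  on the compact interval provides.\<close>

lemma le_SUP_L:
  assumes "0 < m" "m \<le> M" "M < 1" "p \<in> {0..1}"
  shows "max (L1 \<epsilon> m M p) (L2 \<epsilon> m M p) \<le> (SUP p\<in>{0..1}. max (L1 \<epsilon> m M p) (L2 \<epsilon> m M p))"
proof (rule cSUP_upper[OF assms(4)])
  have "1 - (p * M + (1 - p) * m) \<noteq> 0" if "p \<in> {0..1}" for p
  proof -
    have "p * M + (1 - p) * m \<le> p * M + (1 - p) * M" using that assms by (simp add: mult_left_mono)
    then show ?thesis using assms by (simp add: algebra_simps)
  qed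
  then have "continuous_on {0..1} (\<lambda>p. max (L1 \<epsilon> m M p) (L2 \<epsilon> m M p))"
    unfolding L1_def L2_def Let_def using assms by (intro continuous_intros) auto
  then obtain x where "\<forall>p\<in>{0..1}. max (L1 \<epsilon> m M p) (L2 \<epsilon> m M p) \<le> max (L1 \<epsilon> m M x) (L2 \<epsilon> m M x)"
    using continuous_attains_sup[of "{0..1::real}" "\<lambda>p. max (L1 \<epsilon> m M p) (L2 \<epsilon> m M p)"] by auto
  then show "bdd_above ((\<lambda>p. max (L1 \<epsilon> m M p) (L2 \<epsilon> m M p)) ` {0..1})"
    by (intro bdd_aboveI2) auto
qed

section \<open>Choice of the affine majorant\<close>

text \<open>The pair \<open>(v, d)\<close> gives the values at \<open>0\<close> and \<open>D\<close> of an affine majorant: the chord from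
  \<open>0\<close> to \<open>D\<close> yields \<open>L1 (T / D)\<close>, the chord from \<open>D - T\<close> to \<open>D\<close> yields \<open>L2 ((2 * T - D) / T)\<close>, and
  the bound of the chord from \<open>0\<close> to \<open>D - T\<close> is log-convex in \<open>T\<close>, with end values \<open>L1 0\<close> and \<open>L2 0\<close>.\<close>

lemma envelope_le_SUP:
  fixes m M T \<epsilon> :: real
  defines "D \<equiv> M - m" and "s \<equiv> 1 - M"
  assumes m: "0 < m" and M: "M < 1" and \<epsilon>: "0 \<le> \<epsilon>" and T: "0 \<le> T" "T < D"
  obtains v d where "T / (D + s - T) \<le> v" "D / m \<le> d" "D * T / s \<le> T * v + (D - T) * d"
    "(exp \<epsilon> - (exp \<epsilon> - 1) * (m + T)) * exp ((v * (D - T) + d * T) / D)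
       \<le> (SUP p\<in>{0..1}. max (L1 \<epsilon> m M p) (L2 \<epsilon> m M p))"
proof -
  have D: "0 < D" and s: "0 < s" and mM: "m \<le> M" using T M by (auto simp: D_def s_def)
  define c where "c = T / (D + s - T)"
  have c0: "0 \<le> c" using T s by (simp add: c_def)
  let ?S = "SUP p\<in>{0..1}. max (L1 \<epsilon> m M p) (L2 \<epsilon> m M p)"
  have le_L1: "L1 \<epsilon> m M p \<le> ?S" and le_L2: "L2 \<epsilon> m M p \<le> ?S" if "p \<in> {0..1}" for p
    using le_SUP_L[OF m mM M that, of \<epsilon>] by auto
  \<comment> \<open>The test is whether the chord from \<open>0\<close> to \<open>D\<close> passes
    above the middle vertex; if not, the side of \<open>D - T\<close> on which \<open>T\<close> lies
    selects the chord.\<close>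
  consider (L1) "D * T / s \<le> T * c + (D - T) * (D / m)"
    | (low) "T * c + (D - T) * (D / m) < D * T / s" "2 * T \<le> D"
    | (high) "T * c + (D - T) * (D / m) < D * T / s" "D < 2 * T" by linarith
  then show ?thesis
  proof cases
    case L1
    have p: "T / D \<in> {0..1}" using T D by simp
    have "T / D * M + (1 - T / D) * m = m + T / D * (M - m)" by algebra
    also have "M - m = D" by (simp add: D_def)
    finally have A: "T / D * M + (1 - T / D) * m = m + T" using D by simp
    have "M / m = 1 + D / m" "(1 - m) / (1 - (m + T)) = 1 + c"
      using m T s by (simp_all add: D_def c_def s_def field_simps)
    then have "T / D * (M / m) + (1 - T / D) * ((1 - m) / (1 - (m + T))) - 1 = (c * (D - T) + D / m * T) / D"
      using D m by (simp add: field_simps)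
    then have "L1 \<epsilon> m M (T / D) = (exp \<epsilon> - (exp \<epsilon> - 1) * (m + T)) * exp ((c * (D - T) + D / m * T) / D)"
      unfolding L1_def A by simp
    then show ?thesis using that[of c "D / m"] L1 le_L1[OF p] unfolding c_def by simp
  next
    case low
    \<comment> \<open>Value at \<open>D\<close> of the line through the vertices at \<open>0\<close>
      and \<open>D - T\<close>.\<close>
    define d where "d = (D * T / s - T * c) / (D - T)"
    have d: "D / m \<le> d" "D * T / s = T * c + (D - T) * d"
      using low T by (simp_all add: d_def pos_le_divide_eq mult.commute)
    define C where "C = D + s"
    define \<phi> where "\<phi> = (\<lambda>u. (1 + (exp \<epsilon> - 1) * u) * exp ((C - u) * (C + s - u) / (s * u)))"
    \<comment> \<open>With \<open>u = C - T\<close>, the ends \<open>T = D / 2\<close> and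
      \<open>T = 0\<close> give \<open>L2\<close> and \<open>L1\<close> at \<open>0\<close>.\<close>
    have "\<phi> (C - T) \<le> max (\<phi> (C - D / 2)) (\<phi> C)"
      unfolding \<phi>_def using \<epsilon> s D T low by (intro tilted_le_max_endpoints) (auto simp: C_def)
    moreover have "\<phi> C = L1 \<epsilon> m M 0"
    proof -
      have "C = 1 - m" by (simp add: C_def D_def s_def)
      then have "1 + (exp \<epsilon> - 1) * C = exp \<epsilon> - (exp \<epsilon> - 1) * m" by algebra
      moreover have "m \<noteq> 1" using mM M by simp
      ultimately show ?thesis by (simp add: \<phi>_def L1_def)
    qed
    moreover have "\<phi> (C - D / 2) = L2 \<epsilon> m M 0"
    proof -
      have "(C - (C - D / 2)) * (C + s - (C - D / 2)) / (s * (C - D / 2)) = (1 - (M + m) / 2) / (1 - M) - 1"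
      proof -
        have "C - D / 2 \<noteq> 0" using D s by (simp add: C_def)
        moreover have "C + s - (C - D / 2) = C - D / 2" by (simp add: C_def)
        ultimately have "(C - (C - D / 2)) * (C + s - (C - D / 2)) / (s * (C - D / 2)) = (D / 2) / s"
          by (simp only:) simp
        also have "\<dots> = (1 - (M + m) / 2) / (1 - M) - 1" using M by (simp add: D_def s_def field_simps)
        finally show ?thesis .
      qed
      moreover have "1 + (exp \<epsilon> - 1) * (C - D / 2) = exp \<epsilon> - (exp \<epsilon> - 1) * ((M + m) / 2)"
        by (simp add: C_def D_def s_def field_simps)
      ultimately have "\<phi> (C - D / 2) = (exp \<epsilon> - (exp \<epsilon> - 1) * ((M + m) / 2))
          * exp ((1 - (M + m) / 2) / (1 - M) - 1)"
        unfolding \<phi>_def by (simp only:)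
      then show ?thesis by (simp add: L2_def)
    qed
    ultimately have "\<phi> (C - T) \<le> ?S" using le_L1[of 0] le_L2[of 0] by auto
    moreover have "(c * (D - T) + d * T) / D = (C - (C - T)) * (C + s - (C - T)) / (s * (C - T))"
    proof -
      define x where "x = D - T"
      have D': "D = x + T" and x: "0 < x" using T by (auto simp: x_def)
      show ?thesis unfolding d_def c_def C_def D' using x s T by (simp add: divide_simps) algebra
    qed
    moreover have "exp \<epsilon> - (exp \<epsilon> - 1) * (m + T) = 1 + (exp \<epsilon> - 1) * (C - T)"
      by (simp add: C_def D_def s_def algebra_simps)
    ultimately show ?thesis using that[of c d] d unfolding \<phi>_def c_def by simp
  next
    case high
    then have T0: "0 < T" using D by simp
    \<comment> \<open>Value at \<open>0\<close> of the line through the vertices at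
      \<open>D - T\<close> and \<open>D\<close>.\<close>
    define v where "v = (D * T / s - (D - T) * (D / m)) / T"
    have v: "c \<le> v" "D * T / s = T * v + (D - T) * (D / m)"
      using high T0 by (simp_all add: v_def pos_le_divide_eq mult.commute)
    \<comment> \<open>Chosen so that \<open>T = p * D + (1 - p) * (D - T)\<close>.\<close>
    define p where "p = (2 * T - D) / T"
    have p: "p \<in> {0..1}" using high T0 T by (simp add: p_def field_simps)
    have q: "((M + m) - p * M) / (2 - p) = m + (D - T)"
      using T0 D by (simp add: p_def D_def field_simps)
    have A: "p * M + (1 - p) * (m + (D - T)) = m + T"
      using T0 by (simp add: p_def D_def field_simps)
    have "M / m = 1 + D / m" "(1 - (m + (D - T))) / (1 - M) = 1 + T / s"
      using m s by (simp_all add: D_def s_def field_simps)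
    then have E: "p * (M / m) + (1 - p) * ((1 - (m + (D - T))) / (1 - M)) - 1 = p * (D / m) + (1 - p) * (T / s)"
      by (simp add: algebra_simps)
    also have "\<dots> = (v * (D - T) + D / m * T) / D"
      unfolding p_def v_def using T0 D s m by (simp add: divide_simps) algebra
    finally have "L2 \<epsilon> m M p = (exp \<epsilon> - (exp \<epsilon> - 1) * (m + T)) * exp ((v * (D - T) + D / m * T) / D)"
      unfolding L2_def Let_def q A by simp
    then show ?thesis using that[of v "D / m"] v le_L2[OF p] unfolding c_def by simp
  qed
qed

section \<open>The inequality for fixed \<open>N\<close>, by summing over the indices\<close>

theorem theorem5:
  fixes m M \<epsilon> :: real and N :: nat and J :: "nat set" and a z :: "nat \<Rightarrow> real"
  assumes "m \<in> grid_mM" and "M \<in> grid_mM" and "m \<le> M"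
    and "\<epsilon> \<in> grid_eps"
    and "N \<ge> 1"
    and "J \<subseteq> {1..N}"
    and "\<forall>i\<in>{1..N}. m \<le> a i \<and> a i \<le> M"
    and "z \<in> Pset m M N a"
  shows "fJN \<epsilon> m J N a z \<le> (SUP p\<in>{0..1}. max (L1 \<epsilon> m M p) (L2 \<epsilon> m M p))"
proof -
  have m: "0 < m" and M: "M < 1" and \<epsilon>: "0 \<le> \<epsilon>"
    using assms(1,2,4) by (auto simp: grid_mM_def grid_eps_def)
  define n where "n = real N"
  define D where "D = M - m"
  define s where "s = 1 - M"
  define \<alpha> where "\<alpha> i = a i - m" for i
  define y where "y i = z i - m" for i
  define S where "S = (\<Sum>i = 1..N. \<alpha> i)"
  define T where "T = S / (n + 1)"
  have n: "1 \<le> n" using assms(5) by (simp add: n_def)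
  have s: "0 < s" and D: "0 \<le> D" using M assms(3) by (auto simp: s_def D_def)
  have \<alpha>: "0 \<le> \<alpha> i" "\<alpha> i \<le> D" if "i \<in> {1..N}" for i
    using assms(7) that by (auto simp: \<alpha>_def D_def)
  have sum_a: "(\<Sum>i = 1..N. a i) = n * m + S"
    by (simp add: S_def \<alpha>_def n_def sum_subtractf)
  have T: "0 \<le> T" "S = (n + 1) * T" using \<alpha> n by (auto simp: T_def S_def intro!: divide_nonneg_nonneg sum_nonneg)
  have A: "(m + (\<Sum>i = 1..N. a i)) / (real N + 1) = m + T"
    unfolding sum_a using n by (simp add: T(2) n_def[symmetric] field_simps)
  have y: "0 \<le> y i" "n * y i \<le> (n - 1) * D" "n * y i \<le> (n - 2) * \<alpha> i + (n + 1) * T"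
    if "i \<in> {1..N}" for i
  proof -
    have z: "m \<le> z i" "z i \<le> Mi m M N a i" using assms(8) that by (auto simp: Pset_def)
    have "n * z i \<le> n * Mi m M N a i" using z n by (simp add: mult_left_mono)
    also have "\<dots> = min (m + (n - 1) * M) ((n - 2) * (a i - m) + (n * m + S))"
      using n unfolding Mi_def sum_a n_def[symmetric] by simp
    finally show "n * y i \<le> (n - 1) * D" "n * y i \<le> (n - 2) * \<alpha> i + (n + 1) * T"
      unfolding T(2)[symmetric] by (simp_all add: y_def D_def \<alpha>_def algebra_simps)
    show "0 \<le> y i" using z by (simp add: y_def)
  qed
  have yD: "y i \<le> D" if "i \<in> {1..N}" for i
  proof -
    have "n * y i \<le> n * D" using y(2)[OF that] D by (simp add: algebra_simps)
    then show ?thesis using n by simp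
  qed
  have az: "0 \<le> a i \<and> a i \<le> 1 \<and> 0 < z i \<and> z i < 1" if "i \<in> {1..N}" for i
    using \<alpha>[OF that] y(1)[OF that] yD[OF that] m s by (simp add: \<alpha>_def y_def D_def s_def)
  have ratio: "a i / z i - 1 \<le> \<alpha> i / m" "(1 - a i) / (1 - z i) - 1 = (y i - \<alpha> i) / (D + s - y i)"
    if "i \<in> {1..N}" for i
  proof -
    have "a i / z i \<le> a i / m" using az[OF that] y(1)[OF that] m by (intro divide_left_mono) (auto simp: y_def)
    then show "a i / z i - 1 \<le> \<alpha> i / m" using m by (simp add: \<alpha>_def diff_divide_distrib)
    show "(1 - a i) / (1 - z i) - 1 = (y i - \<alpha> i) / (D + s - y i)"
      using az[OF that] by (simp add: \<alpha>_def y_def D_def s_def field_simps)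
  qed
  let ?F = "exp \<epsilon> - (exp \<epsilon> - 1) * (m + T)"
  have sum_D: "(\<Sum>i = 1..N. D - \<alpha> i) = n * D - S" by (simp add: sum_subtractf S_def n_def)
  have "S \<le> n * D"
  proof -
    have "0 \<le> (\<Sum>i = 1..N. D - \<alpha> i)" using \<alpha> by (intro sum_nonneg) auto
    then show ?thesis unfolding sum_D by simp
  qed
  have TD: "T \<le> D"
  proof -
    have "(n + 1) * T \<le> (n + 1) * D" using \<open>S \<le> n * D\<close> T(2) D by (simp add: algebra_simps)
    then show ?thesis using n by simp
  qed
  have F: "0 \<le> ?F"
  proof -
    have "0 \<le> (exp \<epsilon> - 1) * (1 - (m + T))" using \<epsilon> TD s by (simp add: D_def s_def)
    then show ?thesis by (simp add: algebra_simps)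
  qed
  note bound = fJN_le_exp[OF assms(6), of \<epsilon> m a z, unfolded A, OF F az]
  show ?thesis
  \<comment> \<open>In the first case every \<open>\<alpha> i\<close> equals \<open>D\<close> (in
    particular if \<open>m = M\<close>); \<open>k\<close> would be \<open>0\<close>, which excludes
    \<open>ratio_le_affine\<close>.\<close>
  proof (cases "S = n * D")
    case True
    \<comment> \<open>The proportion of the value \<open>M\<close> among the \<open>N + 1\<close>
      numbers \<open>m, a 1, ..., a N\<close>.\<close>
    define p where "p = n / (n + 1)"
    have \<alpha>D: "\<alpha> i = D" if "i \<in> {1..N}" for i
      using sum_nonneg_eq_0_iff[of "{1..N}" "\<lambda>i. D - \<alpha> i"] \<alpha> that sum_D True by auto
    have "fJN \<epsilon> m J N a z \<le> ?F * exp ((\<Sum>i = 1..N. D / m) / (real N + 1))"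
    proof (rule bound)
      fix i assume i: "i \<in> {1..N}"
      show "a i / z i - 1 \<le> D / m" using ratio(1)[OF i] \<alpha>D[OF i] by simp
      have "(y i - \<alpha> i) / (D + s - y i) \<le> 0"
        using \<alpha>D[OF i] yD[OF i] s by (intro divide_nonpos_pos) auto
      also have "0 \<le> D / m" using D m by simp
      finally show "(1 - a i) / (1 - z i) - 1 \<le> D / m" using ratio(2)[OF i] by simp
    qed
    also have "(\<Sum>i = 1..N. D / m) / (real N + 1) = p * (D / m)" by (simp add: p_def n_def)
    also have "?F * exp (p * (D / m)) \<le> L1 \<epsilon> m M p"
    proof -
      have p: "0 \<le> p" "p \<le> 1" using n by (simp_all add: p_def)
      have "T = p * D" using T(2) True n by (simp add: p_def field_simps)
      then have A': "p * M + (1 - p) * m = m + T" by (simp add: D_def algebra_simps)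
      have "1 \<le> (1 - m) / (1 - (m + T))" using T TD s by (simp add: D_def s_def)
      then have "(1 - p) * 1 \<le> (1 - p) * ((1 - m) / (1 - (m + T)))" using p by (intro mult_left_mono) auto
      moreover have "M / m = 1 + D / m" using m by (simp add: D_def field_simps)
      ultimately have "p * (D / m) \<le> p * (M / m) + (1 - p) * ((1 - m) / (1 - (m + T))) - 1"
        by (simp add: algebra_simps)
      then show ?thesis unfolding L1_def A' using F by (simp add: mult_left_mono)
    qed
    also have "\<dots> \<le> (SUP p\<in>{0..1}. max (L1 \<epsilon> m M p) (L2 \<epsilon> m M p))"
      using le_SUP_L[OF m assms(3) M, of p \<epsilon>] n by (simp add: p_def)
    finally show ?thesis .
  next
    case False
    define k where "k = n * D - (n + 1) * T"
    have k: "0 < k" using False \<open>S \<le> n * D\<close> T(2) by (simp add: k_def)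
    have "(n + 1) * T < (n + 1) * D" using k D by (simp add: k_def algebra_simps)
    then have T_less: "T < D" using n by simp
    then have D_pos: "0 < D" using T by simp
    obtain v d where vd: "T / (D + s - T) \<le> v" "D / m \<le> d" "D * T / s \<le> T * v + (D - T) * d"
      and le: "?F * exp ((v * (D - T) + d * T) / D) \<le> (SUP p\<in>{0..1}. max (L1 \<epsilon> m M p) (L2 \<epsilon> m M p))"
      using envelope_le_SUP[OF m M \<epsilon> T(1), folded D_def s_def, OF T_less] by blast
    define b where "b i = v * ((D - \<alpha> i) * (k + D) / k) / D + d * \<alpha> i / D" for i
    have v: "0 \<le> v"
    proof -
      have "0 \<le> T / (D + s - T)" using T T_less s by simp
      then show ?thesis using vd(1) by linarith
    qed
    have d: "0 \<le> d"
    proof -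
      have "0 \<le> D / m" using D m by simp
      then show ?thesis using vd(2) by linarith
    qed
    have "fJN \<epsilon> m J N a z \<le> ?F * exp ((\<Sum>i = 1..N. b i) / (real N + 1))"
    proof (rule bound)
      fix i assume i: "i \<in> {1..N}"
      have "\<alpha> i / m = D / m * \<alpha> i / D" using D_pos by simp
      also have "\<dots> \<le> d * \<alpha> i / D" using vd(2) \<alpha>[OF i] D by (intro divide_right_mono mult_right_mono) auto
      also have "\<dots> \<le> b i" using v \<alpha>[OF i] k D by (simp add: b_def)
      finally show "a i / z i - 1 \<le> b i" using ratio(1)[OF i] by linarith
      show "(1 - a i) / (1 - z i) - 1 \<le> b i"
        unfolding ratio(2)[OF i] b_def
        using ratio_le_affine[OF n D_pos s T(1) k_def k \<alpha>[OF i] y(2,3)[OF i] vd(1) d vd(3)] .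
    qed
    also have "(\<Sum>i = 1..N. b i) / (real N + 1) = (v * (D - T) + d * T) / D"
    proof -
      \<comment> \<open>The \<open>D - \<alpha> i\<close> sum to \<open>k\<close>; the factor
        \<open>(k + D) / k\<close> turns this into \<open>k + D = (n + 1) * (D - T)\<close>, so
        division by \<open>n + 1\<close> leaves the value of the majorant at
        \<open>T\<close>.\<close>
      have "(\<Sum>i = 1..N. b i) = v * ((k + D) / k) / D * (\<Sum>i = 1..N. D - \<alpha> i) + d / D * S"
        by (simp add: b_def S_def sum.distrib sum_distrib_left mult_ac)
      also have "\<dots> = v * (k + D) / D + d / D * S"
        using k unfolding sum_D T(2) k_def[symmetric] by simp
      also have "k + D = (n + 1) * (D - T)" by (simp add: k_def algebra_simps)
      finally have "(\<Sum>i = 1..N. b i) = (n + 1) * ((v * (D - T) + d * T) / D)"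
        by (simp add: T(2) add_divide_distrib distrib_left mult_ac)
      then show ?thesis using n by (simp add: n_def[symmetric])
    qed
    finally show ?thesis using le by linarith
  qed
qed

end
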